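(* Let $\text{\it Hex}=\{E\flat,e\flat,B,b,G,g\}\subset \text{\it Triads}$. The restriction to $\text{\it Hex}$ of the $PL$-group $\langle P,L\rangle\leq \mathrm{Sym}(\text{\it Triads})$ and the restriction to $\text{\it Hex}$ of $\{T_0,T_4,T_8,I_1,I_5,I_9\}\subset \mathrm{Sym}(\text{\it Triads})$ are dual groups in $\mathrm{Sym}(\text{\it Hex})$, and both are dihedral of order $6$.
   Context: Pitch classes are elements of $\mathbb{Z}_{12}$. $\text{\it Triads}$ is the set of the 24 ordered triples in $\mathbb{Z}_{12}$ of the form $\langle x,x+4,x+7\rangle$ (major triads) or $\langle x+7,x+3,x\rangle$ (minor triads), $x\in\mathbb{Z}_{12}$. For $n\in\mathbb{Z}_{12}$, $T_n(x)=x+n$ and $I_n(x)=-x+n$ on $\mathbb{Z}_{12}$; these act on $\text{\it Triads}$ componentwise: $T_n\langle x_1,x_2,x_3\rangle=\langle T_nx_1,T_nx_2,T_nx_3\rangle$ and $I_n\langle x_1,x_2,x_3\rangle=\langle I_nx_1,I_nx_2,I_nx_3\rangle$. The bijections $P,L\colon\text{\it Triads}\to\text{\it Triads}$ are defined by $P\langle x_1,x_2,x_3\rangle=I_{x_1+x_3}\langle x_1,x_2,x_3\rangle$ and $L\langle x_1,x_2,x_3\rangle=I_{x_2+x_3}\langle x_1,x_2,x_3\rangle$. The $PL$-group is the subgroup $\langle P,L\rangle$ of $\mathrm{Sym}(\text{\it Triads})$ generated by $P$ and $L$. The elements of $\text{\it Hex}$ are $E\flat=\langle 3,7,10\rangle$,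 $e\flat=\langle 10,6,3\rangle$, $B=\langle 11,3,6\rangle$, $b=\langle 6,2,11\rangle$, $G=\langle 7,11,2\rangle$, $g=\langle 2,10,7\rangle$. A group action of $G$ on $S$ is simply transitive if for all $Y,Z\in S$ there is a unique $g\in G$ with $gY=Z$. Subgroups $G$ and $H$ of $\mathrm{Sym}(S)$ are dual (in the sense of Lewin) if each acts simply transitively on $S$ and each is the centralizer of the other in $\mathrm{Sym}(S)$. The dihedral group of order $6$ is the symmetry group of the equilateral triangle. *)

theory Defs
  imports
    "HOL-Analysis.Analysis"
    "HOL-Algebra.Generated_Groups"
    "HOL-Algebra.Group_Action"
begin

text \<open>
  The numeral type \<open>12\<close> is the ring of integers modulo 12. The symmetric group on a set
  \<open>S\<close> is \<^term>\<open>BijGroup S\<close>, whose elements are extensional functions; hence maps on a set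
  are introduced with \<^const>\<open>restrict\<close>.
\<close>

type_synonym pitch_class = "12"
type_synonym triple = "pitch_class \<times> pitch_class \<times> pitch_class"

definition Triads :: "triple set" where
  "Triads = {(x, x + 4, x + 7) |x. True} \<union> {(x + 7, x + 3, x) |x. True}"

definition T_pc :: "pitch_class \<Rightarrow> pitch_class \<Rightarrow> pitch_class" where
  "T_pc n x = x + n"

definition I_pc :: "pitch_class \<Rightarrow> pitch_class \<Rightarrow> pitch_class" where
  "I_pc n x = - x + n"

definition componentwise :: "(pitch_class \<Rightarrow> pitch_class) \<Rightarrow> triple \<Rightarrow> triple" where
  "componentwise f = (\<lambda>(x1, x2, x3). (f x1, f x2, f x3))"

definition T_op :: "pitch_class \<Rightarrow> triple \<Rightarrow> triple" where
  "T_op n = (\<lambda>t\<in>Triads. componentwise (T_pc n) t)"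

definition I_op :: "pitch_class \<Rightarrow> triple \<Rightarrow> triple" where
  "I_op n = (\<lambda>t\<in>Triads. componentwise (I_pc n) t)"

definition P_op :: "triple \<Rightarrow> triple" where
  "P_op = (\<lambda>(x1, x2, x3)\<in>Triads. I_op (x1 + x3) (x1, x2, x3))"

definition L_op :: "triple \<Rightarrow> triple" where
  "L_op = (\<lambda>(x1, x2, x3)\<in>Triads. I_op (x2 + x3) (x1, x2, x3))"

definition PL_group :: "(triple \<Rightarrow> triple) set" where
  "PL_group = generate (BijGroup Triads) {P_op, L_op}"

text \<open>The hexatonic set, listed as \<open>E\<flat>, e\<flat>, B, b, G, g\<close>.\<close>

definition Hex :: "triple set" where
  "Hex = {(3, 7, 10), (10, 6, 3), (11, 3, 6), (6, 2, 11), (7, 11, 2), (2, 10, 7)}"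

definition restrict_to :: "('a \<Rightarrow> 'a) set \<Rightarrow> 'a set \<Rightarrow> ('a \<Rightarrow> 'a) set" where
  "restrict_to F S = (\<lambda>f. restrict f S) ` F"

definition PL_Hex :: "(triple \<Rightarrow> triple) set" where
  "PL_Hex = restrict_to PL_group Hex"

definition TI_Hex :: "(triple \<Rightarrow> triple) set" where
  "TI_Hex = restrict_to {T_op 0, T_op 4, T_op 8, I_op 1, I_op 5, I_op 9} Hex"

definition simply_transitive_action ::
    "('g, 'm) monoid_scheme \<Rightarrow> 'a set \<Rightarrow> ('g \<Rightarrow> 'a \<Rightarrow> 'a) \<Rightarrow> bool" where
  "simply_transitive_action G S \<phi> \<longleftrightarrow>
     group_action G S \<phi> \<and> (\<forall>Y\<in>S. \<forall>Z\<in>S. \<exists>!g. g \<in> carrier G \<and> \<phi> g Y = Z)"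

definition centralizer :: "('g, 'm) monoid_scheme \<Rightarrow> 'g set \<Rightarrow> 'g set" where
  "centralizer G H = {g \<in> carrier G. \<forall>h\<in>H. g \<otimes>\<^bsub>G\<^esub> h = h \<otimes>\<^bsub>G\<^esub> g}"

abbreviation perm_group :: "'a set \<Rightarrow> ('a \<Rightarrow> 'a) set \<Rightarrow> ('a \<Rightarrow> 'a) monoid" where
  "perm_group S G \<equiv> (BijGroup S)\<lparr>carrier := G\<rparr>"

definition Lewin_dual :: "'a set \<Rightarrow> ('a \<Rightarrow> 'a) set \<Rightarrow> ('a \<Rightarrow> 'a) set \<Rightarrow> bool" where
  "Lewin_dual S G H \<longleftrightarrow>
     subgroup G (BijGroup S) \<and> subgroup H (BijGroup S) \<and>
     simply_transitive_action (perm_group S G) S (\<lambda>g. g) \<and>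
     simply_transitive_action (perm_group S H) S (\<lambda>h. h) \<and>
     centralizer (BijGroup S) G = H \<and> centralizer (BijGroup S) H = G"

definition symmetry_group :: "'a::metric_space set \<Rightarrow> ('a \<Rightarrow> 'a) monoid" where
  "symmetry_group X = perm_group UNIV
     {f \<in> Bij UNIV. (\<forall>x y. dist (f x) (f y) = dist x y) \<and> f ` X = X}"

definition equilateral_triangle :: "complex set" where
  "equilateral_triangle = convex hull {1, cis (2 * pi / 3), cis (4 * pi / 3)}"

definition dihedral_group_6 :: "(complex \<Rightarrow> complex) monoid" where
  "dihedral_group_6 = symmetry_group equilateral_triangle"

lemma T_op_in_Sym: "T_op n \<in> carrier (BijGroup Triads)"
proof -
  have cl: "componentwise (T_pc k) t \<in> Triads" if "t \<in> Triads" for t k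
    using that by (auto simp: Triads_def componentwise_def T_pc_def algebra_simps)
  have "bij_betw (T_op n) Triads Triads"
    by (rule bij_betw_byWitness[where f' = "T_op (- n)"])
       (auto simp: T_op_def cl, auto simp: componentwise_def T_pc_def)
  then show ?thesis
    by (simp add: BijGroup_def Bij_def T_op_def)
qed

lemma componentwise_I_Triads:
  assumes "t \<in> Triads" shows "componentwise (I_pc n) t \<in> Triads"
proof -
  have "\<exists>y. (- x + n, - (x + 4) + n, - (x + 7) + n) = (y + 7, y + 3, y)" for x
    by (rule exI[of _ "- (x + 7) + n"]) (simp add: algebra_simps)
  moreover have "\<exists>y. (- (x + 7) + n, - (x + 3) + n, - x + n) = (y, y + 4, y + 7)" for x
    by (rule exI[of _ "- (x + 7) + n"]) (simp add: algebra_simps)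
  ultimately show ?thesis
    using assms unfolding Triads_def componentwise_def I_pc_def by fastforce
qed

lemma I_op_in_Sym: "I_op n \<in> carrier (BijGroup Triads)"
proof -
  have "bij_betw (I_op n) Triads Triads"
    by (rule bij_betw_byWitness[where f' = "I_op n"])
       (auto simp: I_op_def componentwise_I_Triads, auto simp: componentwise_def I_pc_def)
  then show ?thesis
    by (simp add: BijGroup_def Bij_def I_op_def)
qed

lemma P_op_in_Sym: "P_op \<in> carrier (BijGroup Triads)"
proof -
  have cl: "P_op t \<in> Triads" if "t \<in> Triads" for t
    using that by (auto simp: P_op_def I_op_def componentwise_I_Triads split: prod.split)
  have inv: "P_op (P_op t) = t" if "t \<in> Triads" for t
    using that cl[OF that]
    by (cases t) (auto simp: P_op_def I_op_def componentwise_def I_pc_def)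
  have "bij_betw P_op Triads Triads"
    by (rule bij_betw_byWitness[where f' = P_op]) (auto simp: cl inv)
  then show ?thesis
    by (simp add: BijGroup_def Bij_def P_op_def)
qed

lemma L_op_in_Sym: "L_op \<in> carrier (BijGroup Triads)"
proof -
  have cl: "L_op t \<in> Triads" if "t \<in> Triads" for t
    using that by (auto simp: L_op_def I_op_def componentwise_I_Triads split: prod.split)
  have inv: "L_op (L_op t) = t" if "t \<in> Triads" for t
    using that cl[OF that]
    by (cases t) (auto simp: L_op_def I_op_def componentwise_def I_pc_def)
  have "bij_betw L_op Triads Triads"
    by (rule bij_betw_byWitness[where f' = L_op]) (auto simp: cl inv)
  then show ?thesis
    by (simp add: BijGroup_def Bij_def L_op_def)
qed

lemma Hex_subset_Triads: "Hex \<subseteq> Triads"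
proof -
  have "(x, x + 4, x + 7) \<in> Triads" "(x + 7, x + 3, x) \<in> Triads" for x
    by (auto simp: Triads_def)
  note tr = this[of 3] this[of 11] this[of 7]
  have "(15 :: pitch_class) = 3" "(18 :: pitch_class) = 6" "(14 :: pitch_class) = 2"
    by simp_all
  with tr show ?thesis
    by (simp add: Hex_def del: eq_numeral_iff_iszero)
qed

end

theory Submission
  imports Defs "HOL-Algebra.Multiplicative_Group"
begin

text \<open>
  If two commuting families of permutations of \<open>S\<close> both move one base point to every point of
  \<open>S\<close>, then a permutation commuting with either family is determined by its value at the base
  point. Hence each family is the full centralizer of the other, so both are subgroups and act
  simply transitively. This applies to \<open>P, L\<close> and the six \<open>T/I\<close> maps on \<open>Hex\<close>, and gives order 6
  for both groups.

  A group of order at most \<open>2 n\<close> containing an element \<open>r\<close> of order \<open>n \<ge> 3\<close> and an involution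
  inverting \<open>r\<close> is unique up to isomorphism. Such pairs are \<open>LP, P\<close> and \<open>T\<^sub>4, I\<^sub>1\<close> on \<open>Hex\<close>, and
  the rotation by \<open>2 pi / 3\<close> together with complex conjugation for the triangle. An isometry
  preserving the triangle permutes its vertices, hence fixes their centroid 0, hence is real linear
  and determined by the images of two vertices; this bounds the order of the symmetry group by 6.
\<close>

section \<open>Dual permutation groups\<close>

lemma BijGroup_carrier: "carrier (BijGroup S) = Bij S"
  by (simp add: BijGroup_def)

lemma BijGroup_mult: "f \<in> Bij S \<Longrightarrow> g \<in> Bij S \<Longrightarrow> f \<otimes>\<^bsub>BijGroup S\<^esub> g = compose S f g"
  by (simp add: BijGroup_def)

lemma BijGroup_one: "\<one>\<^bsub>BijGroup S\<^esub> = (\<lambda>x\<in>S. x)"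
  by (simp add: BijGroup_def)

lemma Bij_closed: "f \<in> Bij S \<Longrightarrow> x \<in> S \<Longrightarrow> f x \<in> S"
  using Bij_imp_funcset by blast

lemma Bij_eqI:
  assumes "f \<in> Bij S" "g \<in> Bij S" "\<And>x. x \<in> S \<Longrightarrow> f x = g x"
  shows "f = g"
  using assms by (meson Bij_imp_extensional extensionalityI)

text \<open>Used to recognise both restricted groups on \<open>Hex\<close> as subgroups: each one
  turns out to be a centralizer, so closure and inverses need no separate check.\<close>

lemma (in group) centralizer_subgroup:
  assumes "H \<subseteq> carrier G"
  shows "subgroup (centralizer G H) G"
proof (rule subgroupI)
  show "centralizer G H \<noteq> {}"
    using assms by (auto simp: centralizer_def intro!: exI[of _ \<one>])
next
  fix a assume a: "a \<in> centralizer G H"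
  have "inv a \<otimes> h = h \<otimes> inv a" if "h \<in> H" for h
  proof -
    have "h \<in> carrier G" "a \<in> carrier G" "a \<otimes> h = h \<otimes> a"
      using a that assms by (auto simp: centralizer_def)
    then show ?thesis
      by (metis inv_closed inv_solve_left inv_solve_right m_assoc m_closed)
  qed
  then show "inv a \<in> centralizer G H"
    using a by (auto simp: centralizer_def)
next
  fix a b assume ab: "a \<in> centralizer G H" "b \<in> centralizer G H"
  have "a \<otimes> b \<otimes> h = h \<otimes> (a \<otimes> b)" if "h \<in> H" for h
  proof -
    have "h \<in> carrier G" "a \<in> carrier G" "b \<in> carrier G" "a \<otimes> h = h \<otimes> a" "b \<otimes> h = h \<otimes> b"
      using ab that assms by (auto simp: centralizer_def)
    then show ?thesis
      by (metis m_assoc)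
  qed
  then show "a \<otimes> b \<in> centralizer G H"
    using ab by (auto simp: centralizer_def)
qed (auto simp: centralizer_def)

text \<open>Every point of \<open>S\<close> has the form \<open>h x0\<close>, and
  \<open>f (h x0) = h (f x0) = h (g x0) = g (h x0)\<close>.\<close>

lemma commuting_eqI:
  assumes "f \<in> Bij S" "g \<in> Bij S" "x0 \<in> S" "f x0 = g x0"
    and "\<And>h x. h \<in> H \<Longrightarrow> x \<in> S \<Longrightarrow> f (h x) = h (f x)"
    and "\<And>h x. h \<in> H \<Longrightarrow> x \<in> S \<Longrightarrow> g (h x) = h (g x)"
    and "\<And>y. y \<in> S \<Longrightarrow> \<exists>h\<in>H. h x0 = y"
  shows "f = g"
  using assms(1,2) by (rule Bij_eqI) (metis assms(3-7))

text \<open>Agreement at an arbitrary \<open>x\<close> is carried back to the base point by some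
  \<open>h\<close> with \<open>h x0 = x\<close>, after which the previous argument applies.
  \<open>G\<close> and \<open>H\<close> are plain sets here; that they are groups is a consequence
  drawn later.\<close>

lemma commuting_transitive_free:
  assumes x0: "x0 \<in> S" and sub: "G \<subseteq> Bij S" "H \<subseteq> Bij S"
    and comm: "\<And>g h x. g \<in> G \<Longrightarrow> h \<in> H \<Longrightarrow> x \<in> S \<Longrightarrow> g (h x) = h (g x)"
    and tH: "\<And>y. y \<in> S \<Longrightarrow> \<exists>h\<in>H. h x0 = y"
    and g: "g \<in> G" "g' \<in> G" "x \<in> S" "g x = g' x"
  shows "g = g'"
proof -
  have gB: "g \<in> Bij S" "g' \<in> Bij S"
    using g sub by auto
  obtain h where h: "h \<in> H" "h x0 = x"
    using tH[OF g(3)] by blast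
  \<comment> \<open>Both sides are rewritten by commutation to \<open>g x\<close> and
    \<open>g' x\<close>.\<close>
  then have "h (g x0) = h (g' x0)"
    using comm g x0 by metis
  moreover have "inj_on h S"
    using h sub by (auto simp: Bij_def bij_betw_def)
  ultimately have "g x0 = g' x0"
    using gB x0 Bij_closed by (meson inj_onD)
  then show ?thesis
    using comm g tH by (intro commuting_eqI[OF gB x0, of H]) auto
qed

text \<open>For \<open>c\<close> in the centralizer, transitivity of \<open>H\<close> supplies an
  \<open>h\<close> agreeing with \<open>c\<close> at \<open>x0\<close>. Both commute with
  \<open>G\<close>, and \<open>G\<close> reaches every point from \<open>x0\<close>, so
  \<open>c = h\<close>.\<close>

lemma centralizer_BijGroup_eqI:
  assumes "x0 \<in> S" "G \<subseteq> Bij S" "H \<subseteq> Bij S"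
    and comm: "\<And>g h x. g \<in> G \<Longrightarrow> h \<in> H \<Longrightarrow> x \<in> S \<Longrightarrow> g (h x) = h (g x)"
    and tG: "\<And>y. y \<in> S \<Longrightarrow> \<exists>g\<in>G. g x0 = y"
    and tH: "\<And>y. y \<in> S \<Longrightarrow> \<exists>h\<in>H. h x0 = y"
  shows "centralizer (BijGroup S) G = H"
proof
  show "H \<subseteq> centralizer (BijGroup S) G"
  proof
    fix h assume h: "h \<in> H"
    have "compose S h g = compose S g h" if "g \<in> G" for g
      using comm[OF that h] by (auto simp: compose_def)
    then show "h \<in> centralizer (BijGroup S) G"
      using h assms(2,3) by (auto simp: centralizer_def BijGroup_carrier BijGroup_mult subset_iff)
  qed
  show "centralizer (BijGroup S) G \<subseteq> H"
  proof
    fix c assume "c \<in> centralizer (BijGroup S) G"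
    then have c: "c \<in> Bij S" and cg: "\<And>g. g \<in> G \<Longrightarrow> compose S c g = compose S g c"
      using assms(2) by (auto simp: centralizer_def BijGroup_carrier BijGroup_mult subset_iff)
    have cgx: "c (g x) = g (c x)" if "g \<in> G" "x \<in> S" for g x
      using fun_cong[OF cg[OF that(1)], of x] that(2) by (simp add: compose_eq)
    obtain h where h: "h \<in> H" "h x0 = c x0"
      using tH Bij_closed[OF c assms(1)] by blast
    have "c = h"
      using c _ assms(1) h(2)[symmetric] cgx _ tG
      by (rule commuting_eqI) (use h assms(3) comm[symmetric] in auto)
    with h show "c \<in> H" by simp
  qed
qed

section \<open>Simple transitivity and duality\<close>

lemma group_perm_group: "subgroup G (BijGroup S) \<Longrightarrow> group (perm_group S G)"
  by (simp add: group.subgroup_imp_group group_BijGroup)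

text \<open>If \<open>g x0 = Y\<close> and \<open>h x0 = Z\<close>, then the product of
  \<open>h\<close> with the inverse of \<open>g\<close> takes \<open>Y\<close> to \<open>Z\<close>
  through the base point; freeness gives uniqueness.\<close>

lemma simply_transitive_actionI:
  assumes "x0 \<in> S" and G: "subgroup G (BijGroup S)"
    and t: "\<And>y. y \<in> S \<Longrightarrow> \<exists>g\<in>G. g x0 = y"
    and free: "\<And>g g' x. g \<in> G \<Longrightarrow> g' \<in> G \<Longrightarrow> x \<in> S \<Longrightarrow> g x = g' x \<Longrightarrow> g = g'"
  shows "simply_transitive_action (perm_group S G) S (\<lambda>g. g)"
  unfolding simply_transitive_action_def
proof (intro conjI ballI)
  \<comment> \<open>An action is a homomorphism into \<open>BijGroup S\<close>; here it is the
    inclusion of the subgroup.\<close>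
  show "group_action (perm_group S G) S (\<lambda>g. g)"
    using group.canonical_inj_is_hom[OF group_BijGroup G]
    by (simp add: group_action_def id_def)
next
  fix Y Z assume YZ: "Y \<in> S" "Z \<in> S"
  interpret B: group "BijGroup S" by (rule group_BijGroup)
  have GB: "G \<subseteq> Bij S"
    using subgroup.subset[OF G] by (simp add: BijGroup_carrier)
  obtain g where g: "g \<in> G" "g x0 = Y" using t YZ by blast
  obtain h where h: "h \<in> G" "h x0 = Z" using t YZ by blast
  let ?k = "inv\<^bsub>BijGroup S\<^esub> g"
  have k: "?k \<in> G" using G g by (simp add: subgroup.m_inv_closed)
  have "?k \<otimes>\<^bsub>BijGroup S\<^esub> g = \<one>\<^bsub>BijGroup S\<^esub>"
    using B.l_inv GB g(1) by (auto simp: BijGroup_carrier)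
  then have "compose S ?k g x0 = x0"
    using k g GB assms(1) by (auto simp: BijGroup_mult BijGroup_one subset_iff)
  then have "?k Y = x0" using g assms(1) by (simp add: compose_eq)
  moreover have "compose S h ?k \<in> G"
    using subgroup.m_closed[OF G h(1) k] h k GB by (auto simp: BijGroup_mult subset_iff)
  ultimately have "\<exists>g\<in>G. g Y = Z"
    using h YZ by (intro bexI[of _ "compose S h ?k"]) (auto simp: compose_eq)
  then show "\<exists>!g. g \<in> carrier (perm_group S G) \<and> g Y = Z"
    using free YZ by auto
qed

text \<open>The hypotheses are symmetric in \<open>G\<close> and \<open>H\<close>, so each fact is
  obtained twice. The centralizer equations come first, the subgroup property follows from them, and
  simple transitivity comes last.\<close>

lemma Lewin_dualI:
  assumes x0: "x0 \<in> S" and sub: "G \<subseteq> Bij S" "H \<subseteq> Bij S"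
    and comm: "\<And>g h x. g \<in> G \<Longrightarrow> h \<in> H \<Longrightarrow> x \<in> S \<Longrightarrow> g (h x) = h (g x)"
    and tG: "\<And>y. y \<in> S \<Longrightarrow> \<exists>g\<in>G. g x0 = y"
    and tH: "\<And>y. y \<in> S \<Longrightarrow> \<exists>h\<in>H. h x0 = y"
  shows "Lewin_dual S G H"
proof -
  have cG: "centralizer (BijGroup S) G = H"
    using x0 sub comm tG tH by (rule centralizer_BijGroup_eqI)
  have cH: "centralizer (BijGroup S) H = G"
    using x0 sub(2,1) comm[symmetric] tH tG by (rule centralizer_BijGroup_eqI)
  have sH: "subgroup H (BijGroup S)"
    using group.centralizer_subgroup[OF group_BijGroup, of G S] cG sub by (simp add: BijGroup_carrier)
  have sG: "subgroup G (BijGroup S)"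
    using group.centralizer_subgroup[OF group_BijGroup, of H S] cH sub by (simp add: BijGroup_carrier)
  have freeG: "g = g'" if "g \<in> G" "g' \<in> G" "x \<in> S" "g x = g' x" for g g' x
    using x0 sub comm tH that by (rule commuting_transitive_free)
  have freeH: "h = h'" if "h \<in> H" "h' \<in> H" "x \<in> S" "h x = h' x" for h h' x
    using x0 sub(2,1) comm[symmetric] tG that by (rule commuting_transitive_free)
  have "simply_transitive_action (perm_group S G) S (\<lambda>g. g)"
    using x0 sG tG freeG by (rule simply_transitive_actionI)
  moreover have "simply_transitive_action (perm_group S H) S (\<lambda>h. h)"
    using x0 sH tH freeH by (rule simply_transitive_actionI)
  ultimately show ?thesis
    using cG cH sG sH by (simp add: Lewin_dual_def)
qed

text \<open>This allows an identity between group elements to be tested at a single point.\<close>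

lemma simply_transitive_perm_group_eqI:
  assumes "simply_transitive_action (perm_group S G) S (\<lambda>g. g)"
    and "subgroup G (BijGroup S)"
    and "g \<in> G" "h \<in> G" "x \<in> S" "g x = h x"
  shows "g = h"
proof -
  have "h x \<in> S"
    using assms(2,4,5) Bij_closed subgroup.subset by (fastforce simp: BijGroup_carrier)
  then show ?thesis
    using assms unfolding simply_transitive_action_def by auto
qed

text \<open>The orbit map at \<open>x\<close> is a bijection from the group onto
  \<open>S\<close>.\<close>

lemma simply_transitive_order:
  assumes st: "simply_transitive_action (perm_group S G) S (\<lambda>g. g)"
    and G: "subgroup G (BijGroup S)" and x: "x \<in> S"
  shows "order (perm_group S G) = card S"
proof -
  have "bij_betw (\<lambda>g. g x) G S"
  proof (rule bij_betw_imageI)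
    show "inj_on (\<lambda>g. g x) G"
      using simply_transitive_perm_group_eqI[OF st G _ _ x] by (auto intro: inj_onI)
    have "g x \<in> S" if "g \<in> G" for g
      using G that x Bij_closed subgroup.subset by (fastforce simp: BijGroup_carrier)
    moreover have "\<exists>g\<in>G. g x = y" if "y \<in> S" for y
      using st x that unfolding simply_transitive_action_def by fastforce
    ultimately show "(\<lambda>g. g x) ` G = S" by force
  qed
  then show ?thesis
    by (simp add: order_def bij_betw_same_card)
qed

section \<open>Dihedral groups\<close>

text \<open>The bound on the order takes the place of generation by \<open>r\<close> and
  \<open>s\<close>: the products \<open>r^i\<close> and \<open>r^i s\<close> already give
  \<open>2 * n\<close> distinct elements, so they exhaust the carrier.\<close>

locale dihedral_generators = group G for G (structure) +
  fixes n :: nat and r s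
  assumes r_closed [simp]: "r \<in> carrier G" and s_closed [simp]: "s \<in> carrier G"
    and n_ge_3: "3 \<le> n" and ord_r: "ord r = n"
    and s_invol: "s \<otimes> s = \<one>" and s_conj_r: "s \<otimes> r \<otimes> s = inv r"
    and finite_carrier: "finite (carrier G)" and order_le: "order G \<le> 2 * n"
begin

text \<open>The normal form \<open>r^i s^b\<close>. Exponents are integers rather than residues, so
  conjugation by \<open>s\<close> is plain negation; the price is that a pair is determined only
  modulo \<open>n\<close>.\<close>

definition elt :: "int \<times> bool \<Rightarrow> 'a" where
  "elt p = r [^] fst p \<otimes> (if snd p then s else \<one>)"

lemma elt_closed [simp]: "elt p \<in> carrier G"
  by (simp add: elt_def)

text \<open>Since \<open>s\<close> is its own inverse, \<open>x\<close> to \<open>s x s\<close> is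
  conjugation, hence an endomorphism; it sends \<open>r\<close> to its inverse and therefore negates
  exponents.\<close>

lemma s_conj_r_int_pow: "s \<otimes> r [^] (i::int) \<otimes> s = r [^] (- i)"
proof -
  have "(\<lambda>x. s \<otimes> x \<otimes> s) \<in> hom G G"
  proof (rule homI)
    fix x y assume "x \<in> carrier G" "y \<in> carrier G"
    then show "s \<otimes> (x \<otimes> y) \<otimes> s = s \<otimes> x \<otimes> s \<otimes> (s \<otimes> y \<otimes> s)"
      using s_invol by (simp add: m_assoc inv_equality flip: m_assoc[of s s])
  qed simp
  then interpret c: group_hom G G "\<lambda>x. s \<otimes> x \<otimes> s"
    by unfold_locales
  show ?thesis
    using c.hom_int_pow[of r i] by (simp add: s_conj_r int_pow_inv int_pow_neg)
qed

lemma s_r_int_pow: "s \<otimes> r [^] (i::int) = r [^] (- i) \<otimes> s"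
proof -
  have "s \<otimes> r [^] i = s \<otimes> r [^] i \<otimes> s \<otimes> s"
    by (simp add: m_assoc s_invol)
  then show ?thesis
    by (simp add: s_conj_r_int_pow)
qed

text \<open>Moving \<open>s\<close> to the right past a power of \<open>r\<close> negates the
  exponent. The flag \<open>b \<noteq> c\<close> is addition modulo 2, reflecting that
  \<open>s\<close> squares to one.\<close>

lemma elt_mult:
  "elt (i, b) \<otimes> elt (j, c) = elt (i + (if b then - j else j), b \<noteq> c)"
proof (cases b)
  case True
  have "r [^] i \<otimes> s \<otimes> (r [^] j \<otimes> t) = r [^] (i - j) \<otimes> (s \<otimes> t)" if "t \<in> carrier G" for t
  proof -
    have "r [^] i \<otimes> s \<otimes> (r [^] j \<otimes> t) = r [^] i \<otimes> (s \<otimes> r [^] j) \<otimes> t"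
      using that by (simp add: m_assoc)
    also have "\<dots> = r [^] i \<otimes> r [^] (- j) \<otimes> (s \<otimes> t)"
      using that by (simp add: s_r_int_pow m_assoc)
    finally show ?thesis
      by (simp flip: int_pow_mult)
  qed
  with True show ?thesis
    by (simp add: elt_def s_invol)
next
  case False
  then show ?thesis
    by (simp add: elt_def int_pow_mult flip: m_assoc)
qed

text \<open>A power of \<open>r\<close> commutes with \<open>r\<close>, so conjugation by it would
  fix \<open>r\<close>; then \<open>r\<close> equals its inverse and \<open>n\<close> divides 2,
  contradicting \<open>n_ge_3\<close>.\<close>

lemma s_not_power: "s \<noteq> r [^] (i::int)"
proof
  assume s: "s = r [^] i"
  then have "s \<otimes> r = r \<otimes> s"
    by (metis add.commute int_pow_1 int_pow_mult r_closed)
  then have "s \<otimes> r \<otimes> s = r"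
    by (simp add: m_assoc s_invol)
  then have "r \<otimes> r = \<one>"
    using s_conj_r by (metis r_closed r_inv)
  then have "r [^] (2::nat) = \<one>"
    by (simp add: numeral_2_eq_2)
  then have "n dvd 2"
    using pow_eq_id[of r 2] ord_r by simp
  then show False
    using n_ge_3 dvd_imp_le[of n 2] by simp
qed

text \<open>Products with and without \<open>s\<close> never meet, since \<open>s\<close> is not a
  power of \<open>r\<close>; within one kind, equality is congruence of exponents modulo the order
  of \<open>r\<close>.\<close>

lemma elt_eq_iff: "elt p = elt q \<longleftrightarrow> int n dvd fst q - fst p \<and> snd p = snd q"
proof -
  have ne: "r [^] i \<otimes> s \<noteq> r [^] j" for i j :: int
  proof
    assume "r [^] i \<otimes> s = r [^] j"
    then have "s = r [^] (- i) \<otimes> r [^] j"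
      by (metis int_pow_closed int_pow_neg inv_solve_left r_closed s_closed)
    then show False
      using s_not_power by (metis int_pow_mult r_closed)
  qed
  show ?thesis
    using ne[of "fst p" "fst q"] ne[of "fst q" "fst p"]
    by (auto simp: elt_def ord_r int_pow_eq[OF r_closed])
qed

lemma range_elt: "range elt = carrier G"
proof -
  \<comment> \<open>One representative pair for each congruence class, \<open>2 * n\<close> in
    all.\<close>
  let ?D = "{0..<int n} \<times> (UNIV :: bool set)"
  have "inj_on elt ?D"
  proof (rule inj_onI)
    fix p q assume *: "p \<in> ?D" "q \<in> ?D" "elt p = elt q"
    then have "int n dvd fst q - fst p" "\<bar>fst q - fst p\<bar> < int n" "snd p = snd q"
      by (auto simp: elt_eq_iff)
    then show "p = q"
      using dvd_imp_le_int[of "fst q - fst p" "int n"] by (force simp: prod_eq_iff)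
  qed
  then have "card (elt ` ?D) = 2 * n"
    by (simp add: card_image card_cartesian_product)
  then have "elt ` ?D = carrier G"
    using order_le finite_carrier by (intro card_seteq) (auto simp: order_def)
  then show ?thesis
    by auto
qed

end

text \<open>The product rule and the equality criterion for normal forms mention \<open>n\<close>
  alone, so sending a normal form in \<open>G\<close> to the same one in \<open>H\<close> is well
  defined, injective and multiplicative.\<close>

theorem dihedral_generators_iso:
  assumes "dihedral_generators G n r s" "dihedral_generators H n r' s'"
  shows "G \<cong> H"
proof -
  interpret A: dihedral_generators G n r s by fact
  interpret B: dihedral_generators H n r' s' by fact
  \<comment> \<open>\<open>inv_into\<close> selects an arbitrary representative; the equality
    criterion makes the value independent of that choice.\<close>
  define \<phi> where "\<phi> x = B.elt (inv_into UNIV A.elt x)" for x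
  have \<phi>: "\<phi> (A.elt p) = B.elt p" for p
  proof -
    have "A.elt (inv_into UNIV A.elt (A.elt p)) = A.elt p"
      by (simp add: f_inv_into_f)
    then show ?thesis
      by (simp add: \<phi>_def A.elt_eq_iff B.elt_eq_iff)
  qed
  have "\<phi> \<in> hom G H"
  proof (rule homI)
    fix x y assume "x \<in> carrier G" "y \<in> carrier G"
    then obtain i b j c where "x = A.elt (i, b)" "y = A.elt (j, c)"
      using A.range_elt by (metis image_iff surj_pair)
    then show "\<phi> (x \<otimes>\<^bsub>G\<^esub> y) = \<phi> x \<otimes>\<^bsub>H\<^esub> \<phi> y"
      by (simp add: A.elt_mult B.elt_mult \<phi>)
  qed (simp add: \<phi>_def)
  moreover have "bij_betw \<phi> (carrier G) (carrier H)"
  proof (rule bij_betw_imageI)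
    show "inj_on \<phi> (carrier G)"
      unfolding A.range_elt[symmetric]
      by (auto intro!: inj_onI simp: \<phi> A.elt_eq_iff B.elt_eq_iff)
    show "\<phi> ` carrier G = carrier H"
      unfolding A.range_elt[symmetric] B.range_elt[symmetric] by (simp add: image_image \<phi>)
  qed
  ultimately show ?thesis
    by (auto simp: is_iso_def iso_def)
qed

text \<open>The relations \<open>r^3 = s^2 = (r s)^2 = 1\<close>, each stated as a product equal to
  one so that it can be evaluated at a point. As 3 is prime, \<open>r \<noteq> \<one>\<close> forces
  order exactly 3.\<close>

lemma (in group) dihedral_generators_3I:
  assumes "r \<in> carrier G" "s \<in> carrier G" "r \<noteq> \<one>" "r \<otimes> (r \<otimes> r) = \<one>"
    and "s \<otimes> s = \<one>" "r \<otimes> s \<otimes> (r \<otimes> s) = \<one>"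
    and "finite (carrier G)" "order G \<le> 6"
  shows "dihedral_generators G 3 r s"
proof
  have "r [^] (3::nat) = \<one>"
    using assms by (simp add: numeral_3_eq_3 m_assoc)
  then have "ord r dvd 3"
    using assms pow_eq_id by blast
  moreover have "ord r \<noteq> 1"
    using assms ord_eq_1 by blast
  ultimately show "ord r = 3"
    using prime_nat_iff[of 3] by auto
  have "r \<otimes> (s \<otimes> r \<otimes> s) = \<one>"
    using assms by (simp add: m_assoc)
  then show "s \<otimes> r \<otimes> s = inv r"
    using assms by (metis inv_equality inv_inv m_closed)
qed (use assms in simp_all)

text \<open>Under simple transitivity an element fixing \<open>x\<close> is the identity, so the
  dihedral relations hold as soon as they hold at \<open>x\<close>.\<close>

lemma simply_transitive_dihedral:
  assumes st: "simply_transitive_action (perm_group S G) S (\<lambda>g. g)"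
    and G: "subgroup G (BijGroup S)" and S: "card S = 6" and x: "x \<in> S"
    and rs: "r \<in> G" "s \<in> G"
    and rel: "r x \<noteq> x" "r (r (r x)) = x" "s (s x) = x" "r (s (r (s x))) = x"
  shows "dihedral_generators (perm_group S G) 3 r s"
proof -
  interpret P: group "perm_group S G"
    by (rule group_perm_group[OF G])
  have GB: "f \<in> Bij S" if "f \<in> G" for f
    using that subgroup.subset[OF G] by (auto simp: BijGroup_carrier)
  have closed: "f \<otimes>\<^bsub>BijGroup S\<^esub> g \<in> G" if "f \<in> G" "g \<in> G" for f g
    using G that by (rule subgroup.m_closed)
  have apply_mult: "(f \<otimes>\<^bsub>BijGroup S\<^esub> g) y = f (g y)" if "f \<in> G" "g \<in> G" "y \<in> S" for f g y
    using that by (simp add: BijGroup_mult GB compose_eq)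
  have one: "\<one>\<^bsub>BijGroup S\<^esub> \<in> G" "\<one>\<^bsub>BijGroup S\<^esub> x = x"
    using subgroup.one_closed[OF G] x by (auto simp: BijGroup_one)
  note eqI = simply_transitive_perm_group_eqI[OF st G _ one(1) x]
  have ord: "order (perm_group S G) = 6"
    using simply_transitive_order[OF st G x] S by simp
  show ?thesis
  proof (rule P.dihedral_generators_3I)
    show "finite (carrier (perm_group S G))"
      using ord by (auto simp: order_def intro: card_ge_0_finite)
    show "r \<noteq> \<one>\<^bsub>perm_group S G\<^esub>"
      using rel(1) one(2) by auto
  qed (use rs rel ord in \<open>auto intro!: eqI closed simp: apply_mult closed x one GB Bij_closed\<close>)
qed

section \<open>Symmetries of the equilateral triangle\<close>

lemma subgroup_isometries:
  "subgroup {f \<in> Bij UNIV. (\<forall>x y. dist (f x) (f y) = dist x y) \<and> f ` X = X}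
     (BijGroup (UNIV :: 'a::metric_space set))" (is "subgroup ?D _")
proof -
  interpret B: group "BijGroup (UNIV :: 'a set)" by (rule group_BijGroup)
  have Bij: "Bij (UNIV :: 'a set) = {f. bij f}"
    by (auto simp: Bij_def)
  have inv: "inv\<^bsub>BijGroup UNIV\<^esub> f = inv_into UNIV f" if "bij f" for f :: "'a \<Rightarrow> 'a"
    using that
    by (intro B.inv_equality) (auto simp: BijGroup_carrier BijGroup_mult BijGroup_one Bij
        bij_imp_bij_inv compose_def bij_is_inj)
  show ?thesis
  proof (rule B.subgroupI)
    show "?D \<subseteq> carrier (BijGroup UNIV)"
      by (auto simp: BijGroup_carrier)
    show "?D \<noteq> {}"
      by (auto simp: Bij intro!: exI[of _ id])
    fix f assume f: "f \<in> ?D"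
    then have "bij f" and iso: "\<And>x y. dist (f x) (f y) = dist x y" and X: "f ` X = X"
      by (simp_all add: Bij)
    have "dist (inv_into UNIV f x) (inv_into UNIV f y) = dist x y" for x y
      using iso[of "inv_into UNIV f x" "inv_into UNIV f y"] \<open>bij f\<close>
      by (simp add: bij_is_surj surj_f_inv_f)
    moreover have "inv_into UNIV f ` X = X"
      using image_inv_f_f[OF bij_is_inj[OF \<open>bij f\<close>], of X] X by simp
    ultimately show "inv\<^bsub>BijGroup UNIV\<^esub> f \<in> ?D"
      using \<open>bij f\<close> by (simp add: inv Bij bij_imp_bij_inv)
    fix g assume g: "g \<in> ?D"
    have "compose UNIV f g = f \<circ> g"
      by (auto simp: compose_def)
    moreover have "bij (f \<circ> g)" "(f \<circ> g) ` X = X"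
      using f g by (simp_all add: Bij bij_comp image_comp[symmetric] del: comp_apply o_apply)
    ultimately show "f \<otimes>\<^bsub>BijGroup UNIV\<^esub> g \<in> ?D"
      using f g by (simp add: BijGroup_mult Bij)
  qed
qed

lemma group_symmetry_group: "group (symmetry_group X)"
  unfolding symmetry_group_def by (rule group_perm_group[OF subgroup_isometries])

text \<open>Betweenness is equality in the triangle inequality, hence a purely metric notion. This
  does not presuppose that \<open>f\<close> is linear or affine, which is established only
  afterwards.\<close>

lemma isometry_extreme_point:
  fixes f :: "'a::euclidean_space \<Rightarrow> 'a"
  assumes iso: "\<And>x y. dist (f x) (f y) = dist x y" and x: "x extreme_point_of S"
  shows "f x extreme_point_of f ` S"
proof -
  have inj: "f a = f b \<longleftrightarrow> a = b" for a b
    by (metis iso dist_eq_0_iff)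
  have "f c \<in> open_segment (f a) (f b) \<longleftrightarrow> c \<in> open_segment a b" for a b c
    by (simp add: open_segment_def inj iso between flip: between_mem_segment)
  then show ?thesis
    using x by (auto simp: extreme_point_of_def)
qed

text \<open>A point inside an open segment is strictly closer to 0 than at least one of the
  ends.\<close>

lemma extreme_point_of_max_norm:
  fixes S :: "'a::euclidean_space set"
  assumes "x \<in> S" "\<And>y. y \<in> S \<Longrightarrow> norm y \<le> norm x"
  shows "x extreme_point_of S"
proof -
  have "x \<notin> open_segment a b" if "a \<in> S" "b \<in> S" for a b
    using dist_decreases_open_segment[of x a b 0] assms that by fastforce
  with assms(1) show ?thesis
    by (auto simp: extreme_point_of_def)
qed

section \<open>The vertices as cube roots of unity\<close>

abbreviation \<omega> :: complex where
  "\<omega> \<equiv> cis (2 * pi / 3)"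

lemma omega_eq: "\<omega> = Complex (- 1 / 2) (sqrt 3 / 2)"
  by (simp add: complex_eq_iff cos_120 sin_120)

lemma omega_squared: "cis (4 * pi / 3) = cnj \<omega>" "\<omega> * \<omega> = cnj \<omega>"
proof -
  have *: "\<omega> * \<omega> = cis (4 * pi / 3)"
    by (simp add: cis_mult)
  show "\<omega> * \<omega> = cnj \<omega>"
    unfolding omega_eq by (simp add: complex_eq_iff)
  with * show "cis (4 * pi / 3) = cnj \<omega>" by simp
qed

lemma omega_mult_cnj: "\<omega> * cnj \<omega> = 1"
  unfolding omega_eq by (simp add: complex_eq_iff)

definition vertices :: "complex set" where
  "vertices = {1, \<omega>, cnj \<omega>}"

lemma triangle_eq: "equilateral_triangle = convex hull vertices"
  by (simp add: equilateral_triangle_def vertices_def omega_squared)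

lemma vertices_distinct: "\<omega> \<noteq> 1" "cnj \<omega> \<noteq> 1" "\<omega> \<noteq> cnj \<omega>"
  unfolding omega_eq by (auto simp: complex_eq_iff)

lemma card_vertices: "card vertices = 3" "finite vertices"
  using vertices_distinct by (auto simp: vertices_def)

lemma sum_vertices: "\<Sum>vertices = 0"
  using vertices_distinct by (simp add: vertices_def) (simp add: omega_eq complex_eq_iff)

text \<open>Extreme points of a hull lie among its generators. Conversely the vertices have norm 1
  while the triangle lies in the closed unit disc, so each vertex has maximal norm.\<close>

lemma extreme_point_of_triangle: "x extreme_point_of equilateral_triangle \<longleftrightarrow> x \<in> vertices"
proof
  show "x extreme_point_of equilateral_triangle \<Longrightarrow> x \<in> vertices"
    unfolding triangle_eq by (rule extreme_point_of_convex_hull)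
  have norm: "norm v = 1" if "v \<in> vertices" for v
    using that by (auto simp: vertices_def)
  then have "convex hull vertices \<subseteq> cball 0 1"
    by (intro hull_minimal) auto
  moreover assume x: "x \<in> vertices"
  ultimately show "x extreme_point_of equilateral_triangle"
    unfolding triangle_eq using norm[OF x]
    by (intro extreme_point_of_max_norm) (auto intro: hull_inc)
qed

text \<open>Vertices are extreme points, which an isometry preserves; injectivity and finiteness
  turn the inclusion into equality.\<close>

lemma triangle_symmetry_permutes_vertices:
  assumes iso: "\<And>x y. dist (f x) (f y) = dist x y"
    and f: "f ` equilateral_triangle = equilateral_triangle"
  shows "f ` vertices = vertices"
proof (rule card_subset_eq)
  show "f ` vertices \<subseteq> vertices"
    using isometry_extreme_point[of f, OF iso] f by (metis extreme_point_of_triangle image_subsetI)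
  have "inj f"
    by (metis iso dist_eq_0_iff injI)
  then show "card (f ` vertices) = card vertices"
    by (metis card_image inj_on_subset subset_UNIV)
qed (simp add: card_vertices)

lemma triangle_symmetry_linear:
  assumes iso: "\<And>x y. dist (f x) (f y) = dist x y"
    and f: "f ` equilateral_triangle = equilateral_triangle"
  shows "linear f"
proof -
  \<comment> \<open>An isometry fixing 0 is linear, so it remains to see that the translation part
    \<open>f 0\<close> vanishes. Summing \<open>f\<close> over the permuted vertices, whose sum is
    0, gives \<open>3 * f 0 = 0\<close>.\<close>
  define g where "g x = f x - f 0" for x
  have g: "linear g"
    using iso by (intro isometry_linear) (auto simp: g_def dist_norm)
  have inj: "inj_on f vertices"
    by (metis iso dist_eq_0_iff inj_onI)
  have "0 = \<Sum>(f ` vertices)"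
    using triangle_symmetry_permutes_vertices[OF assms] sum_vertices by simp
  also have "\<dots> = (\<Sum>v\<in>vertices. g v + f 0)"
    by (simp add: sum.reindex[OF inj] g_def)
  also have "\<dots> = g (\<Sum>vertices) + 3 * f 0"
    by (simp add: sum.distrib card_vertices linear_sum[OF g])
  also have "\<dots> = 3 * f 0"
    using linear_0[OF g] by (simp add: sum_vertices)
  finally have "f = g"
    by (auto simp: g_def)
  with g show ?thesis by simp
qed

lemma linear_eq_on_1_omega:
  fixes f g :: "complex \<Rightarrow> complex"
  assumes "linear f" "linear g" "f 1 = g 1" "f \<omega> = g \<omega>"
  shows "f = g"
proof
  fix z
  \<comment> \<open>Coordinates in the real basis \<open>1\<close>, \<open>\<omega>\<close>: the
    imaginary part \<open>sqrt 3 / 2\<close> of \<open>\<omega>\<close> determines \<open>b\<close>,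
    and its real part \<open>- 1 / 2\<close> is compensated by \<open>b / 2\<close>.\<close>
  define b where "b = 2 * Im z / sqrt 3"
  have z: "z = (Re z + b / 2) *\<^sub>R 1 + b *\<^sub>R \<omega>"
    unfolding omega_eq b_def by (simp add: complex_eq_iff)
  show "f z = g z"
    using assms by (subst (1 2) z) (simp only: linear_add linear_scale)
qed

section \<open>Order bound and generators of the triangle group\<close>

lemma dihedral_group_6_carrier:
  "carrier dihedral_group_6 =
     {f. bij f \<and> (\<forall>x y. dist (f x) (f y) = dist x y) \<and> f ` equilateral_triangle = equilateral_triangle}"
  by (auto simp: dihedral_group_6_def symmetry_group_def Bij_def)

lemma dihedral_group_6_mult:
  "f \<in> carrier dihedral_group_6 \<Longrightarrow> g \<in> carrier dihedral_group_6 \<Longrightarrow>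
     f \<otimes>\<^bsub>dihedral_group_6\<^esub> g = f \<circ> g"
  by (auto simp: dihedral_group_6_def symmetry_group_def BijGroup_mult compose_def)

lemma dihedral_group_6_one: "\<one>\<^bsub>dihedral_group_6\<^esub> = (\<lambda>x. x)"
  by (auto simp: dihedral_group_6_def symmetry_group_def BijGroup_one)

text \<open>A symmetry is determined by the images of \<open>1\<close> and \<open>\<omega>\<close>,
  which form an ordered pair of distinct vertices; there are \<open>3 * 2\<close> such
  pairs.\<close>

lemma dihedral_group_6_order_le:
  "finite (carrier dihedral_group_6)" "order dihedral_group_6 \<le> 6"
proof -
  let ?\<Phi> = "\<lambda>f :: complex \<Rightarrow> complex. (f 1, f \<omega>)"
  let ?W = "SIGMA a:vertices. vertices - {a}"
  have inj: "inj_on ?\<Phi> (carrier dihedral_group_6)"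
    by (rule inj_onI)
      (auto simp: dihedral_group_6_carrier intro!: linear_eq_on_1_omega triangle_symmetry_linear)
  have sub: "?\<Phi> ` carrier dihedral_group_6 \<subseteq> ?W"
  proof
    fix p assume "p \<in> ?\<Phi> ` carrier dihedral_group_6"
    then obtain f where f: "bij f" "\<And>x y. dist (f x) (f y) = dist x y"
      "f ` equilateral_triangle = equilateral_triangle" and p: "p = (f 1, f \<omega>)"
      by (auto simp: dihedral_group_6_carrier)
    have "f v \<in> vertices" if "v \<in> vertices" for v
      using triangle_symmetry_permutes_vertices[OF f(2,3)] that by blast
    moreover have "f \<omega> \<noteq> f 1"
      using vertices_distinct(1) f(1) by (metis bij_pointE)
    ultimately show "p \<in> ?W"
      by (auto simp: p vertices_def)
  qed
  have fin: "finite ?W"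
    by (simp add: card_vertices)
  have "card ?W = 6"
    by (simp add: card_vertices)
  then show "order dihedral_group_6 \<le> 6"
    using card_inj_on_le[OF inj sub fin] by (simp add: order_def)
  show "finite (carrier dihedral_group_6)"
    using inj sub fin by (meson finite_imageD finite_subset)
qed

lemma linear_image_triangle:
  assumes "linear f" "f ` vertices = vertices"
  shows "f ` equilateral_triangle = equilateral_triangle"
  using assms by (simp add: triangle_eq convex_hull_linear_image)

lemma dihedral_generators_triangle:
  "dihedral_generators dihedral_group_6 3 (\<lambda>z. \<omega> * z) cnj"
proof -
  interpret D: group dihedral_group_6
    unfolding dihedral_group_6_def by (rule group_symmetry_group)
  have "(\<lambda>z. \<omega> * z) ` vertices = vertices"
    by (auto simp: vertices_def omega_squared omega_mult_cnj)
  then have "(\<lambda>z. \<omega> * z) ` equilateral_triangle = equilateral_triangle"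
    by (intro linear_image_triangle) (auto intro!: linearI simp: algebra_simps)
  moreover have "bij (\<lambda>z. \<omega> * z)"
    by (rule bij_betw_byWitness[where f' = "\<lambda>z. cnj \<omega> * z"])
      (auto simp: omega_mult_cnj mult.commute[of "cnj \<omega>"] simp flip: mult.assoc)
  moreover have "dist (\<omega> * x) (\<omega> * y) = dist x y" for x y
    by (simp add: dist_norm norm_mult flip: right_diff_distrib)
  ultimately have r: "(\<lambda>z. \<omega> * z) \<in> carrier dihedral_group_6"
    by (simp add: dihedral_group_6_carrier)
  have "cnj ` vertices = vertices"
    by (auto simp: vertices_def)
  then have "cnj ` equilateral_triangle = equilateral_triangle"
    by (intro linear_image_triangle) (auto intro!: linearI)
  moreover have "bij cnj"
    by (rule bij_betw_byWitness[where f' = cnj]) auto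
  moreover have "dist (cnj x) (cnj y) = dist x y" for x y
    by (simp add: dist_norm flip: complex_cnj_diff)
  ultimately have s: "cnj \<in> carrier dihedral_group_6"
    by (simp add: dihedral_group_6_carrier)
  have ass: "\<omega> * (\<omega> * z) = cnj \<omega> * z" "\<omega> * (cnj \<omega> * z) = z" for z
    by (simp_all add: omega_squared omega_mult_cnj flip: mult.assoc)
  show ?thesis
  proof (rule D.dihedral_generators_3I)
    show "(\<lambda>z. \<omega> * z) \<noteq> \<one>\<^bsub>dihedral_group_6\<^esub>"
      using vertices_distinct(1) by (auto simp: dihedral_group_6_one fun_eq_iff intro!: exI[of _ 1])
  qed (use r s D.m_closed[OF r r] D.m_closed[OF r s] in
      \<open>auto simp: dihedral_group_6_mult dihedral_group_6_one fun_eq_iff ass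
        dihedral_group_6_order_le\<close>)
qed

section \<open>The hexatonic set\<close>

lemma componentwise_T: "componentwise (T_pc n) (x, y, z) = (x + n, y + n, z + n)"
  by (simp add: componentwise_def T_pc_def)

lemma componentwise_I: "componentwise (I_pc n) (x, y, z) = (n - x, n - y, n - z)"
  by (simp add: componentwise_def I_pc_def)

lemma P_op_apply: "(x, y, z) \<in> Triads \<Longrightarrow> P_op (x, y, z) = (z, x + z - y, x)"
  by (simp add: P_op_def I_op_def componentwise_I)

lemma L_op_apply: "(x, y, z) \<in> Triads \<Longrightarrow> L_op (x, y, z) = (y + z - x, z, y)"
  by (simp add: L_op_def I_op_def componentwise_I)

lemma T_op_apply: "(x, y, z) \<in> Triads \<Longrightarrow> T_op n (x, y, z) = (x + n, y + n, z + n)"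
  by (simp add: T_op_def componentwise_T)

lemma I_op_apply: "(x, y, z) \<in> Triads \<Longrightarrow> I_op n (x, y, z) = (n - x, n - y, n - z)"
  by (simp add: I_op_def componentwise_I)

lemma P_op_closed: "t \<in> Triads \<Longrightarrow> P_op t \<in> Triads"
  using P_op_in_Sym by (simp add: BijGroup_carrier Bij_closed)

lemma L_op_closed: "t \<in> Triads \<Longrightarrow> L_op t \<in> Triads"
  using L_op_in_Sym by (simp add: BijGroup_carrier Bij_closed)

lemma T_op_closed: "t \<in> Triads \<Longrightarrow> T_op n t \<in> Triads"
  using T_op_in_Sym by (simp add: BijGroup_carrier Bij_closed)

lemma I_op_closed: "t \<in> Triads \<Longrightarrow> I_op n t \<in> Triads"
  using I_op_in_Sym by (simp add: BijGroup_carrier Bij_closed)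

text \<open>In coordinates, every component of \<open>P_op\<close> and \<open>L_op\<close> is an
  integer combination of \<open>x\<close>, \<open>y\<close>, \<open>z\<close> with coefficient sum
  1. Such combinations commute with the affine maps \<open>x + n\<close> and
  \<open>n - x\<close>.\<close>

lemma PL_TI_commute:
  assumes "t \<in> Triads"
  shows "P_op (T_op n t) = T_op n (P_op t)" "P_op (I_op n t) = I_op n (P_op t)"
    "L_op (T_op n t) = T_op n (L_op t)" "L_op (I_op n t) = I_op n (L_op t)"
proof -
  obtain x y z where t: "t = (x, y, z)" by (cases t)
  \<comment> \<open>The coordinate formulas hold only on \<open>Triads\<close>, so the inner image
    must be known to lie there before the outer map is evaluated.\<close>
  note cl = P_op_closed[OF assms] L_op_closed[OF assms] T_op_closed[OF assms, of n]
    I_op_closed[OF assms, of n]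
  show "P_op (T_op n t) = T_op n (P_op t)" "P_op (I_op n t) = I_op n (P_op t)"
    "L_op (T_op n t) = T_op n (L_op t)" "L_op (I_op n t) = I_op n (L_op t)"
    using assms cl unfolding t
    by (simp_all add: P_op_apply L_op_apply T_op_apply I_op_apply algebra_simps)
qed

text \<open>Lets stability of \<open>Hex\<close> and commutation with the T/I maps be checked on the
  generators \<open>P_op\<close> and \<open>L_op\<close> and then pass to the whole generated
  group.\<close>

lemma subgroup_commuting_stabilizer:
  assumes "S \<subseteq> U" and J: "\<And>j x. j \<in> J \<Longrightarrow> x \<in> S \<Longrightarrow> j x \<in> S"
  shows "subgroup {f \<in> Bij U. f ` S = S \<and> (\<forall>j\<in>J. \<forall>x\<in>S. f (j x) = j (f x))} (BijGroup U)"
    (is "subgroup ?K _")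
proof -
  interpret B: group "BijGroup U" by (rule group_BijGroup)
  show ?thesis
  proof (rule B.subgroupI)
    show "?K \<subseteq> carrier (BijGroup U)"
      by (auto simp: BijGroup_carrier)
    have "(\<lambda>x\<in>U. x) ` S = S"
      using assms(1) by (auto simp: subset_iff image_iff)
    then have "(\<lambda>x\<in>U. x) \<in> ?K"
      using assms by (auto simp: id_Bij subset_iff)
    then show "?K \<noteq> {}" by blast
    fix f assume f: "f \<in> ?K"
    then have fS: "f ` S = S" by simp
    let ?k = "inv\<^bsub>BijGroup U\<^esub> f"
    have k: "?k \<in> Bij U"
      using f B.inv_closed by (simp add: BijGroup_carrier)
    have "compose U ?k f = (\<lambda>x\<in>U. x)"
      using B.l_inv[of f] f k by (simp add: BijGroup_mult BijGroup_one BijGroup_carrier)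
    then have kf: "?k (f x) = x" if "x \<in> S" for x
      using that assms(1) by (metis compose_eq restrict_apply' subsetD)
    have "?k ` S = ?k ` f ` S"
      using f by simp
    also have "\<dots> = S"
      using kf by (force simp: image_image)
    finally have "?k ` S = S" .
    moreover have "?k (j x) = j (?k x)" if j: "j \<in> J" and x: "x \<in> S" for j x
    proof -
      \<comment> \<open>Writing \<open>x = f y\<close> moves \<open>j\<close> past \<open>f\<close>;
        as \<open>j y\<close> stays in \<open>S\<close>, the inverse cancels \<open>f\<close> and
        leaves \<open>j y\<close>.\<close>
      obtain y where y: "y \<in> S" "x = f y"
        using fS x by blast
      then have "?k (j x) = ?k (f (j y))"
        using f j by simp
      then show ?thesis
        using kf J y j by simp
    qed
    ultimately show "?k \<in> ?K"
      using k by simp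
    fix g assume g: "g \<in> ?K"
    then have "g ` S = S" by simp
    then have gS: "g x \<in> S" if "x \<in> S" for x
      using that by blast
    have fg: "compose U f g x = f (g x)" if "x \<in> S" for x
      using that assms(1) by (auto simp: compose_eq)
    have "compose U f g ` S = f ` g ` S"
      using fg by (auto simp: image_image)
    then have "compose U f g ` S = S"
      using f g by simp
    then show "f \<otimes>\<^bsub>BijGroup U\<^esub> g \<in> ?K"
      using f g fg gS J by (simp add: BijGroup_mult compose_Bij)
  qed
qed

lemma restrict_in_Bij:
  assumes "f \<in> Bij U" "S \<subseteq> U" "f ` S = S"
  shows "restrict f S \<in> Bij S"
  using assms inj_on_subset[of f U S] by (simp add: Bij_def bij_betw_def)

section \<open>Action on the six hexatonic triads\<close>

lemma Hex_Triads:
  "(3, 7, 10) \<in> Triads" "(10, 6, 3) \<in> Triads" "(11, 3, 6) \<in> Triads"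
  "(6, 2, 11) \<in> Triads" "(7, 11, 2) \<in> Triads" "(2, 10, 7) \<in> Triads"
  using Hex_subset_Triads unfolding Hex_def by blast+

lemma P_op_Hex:
  "P_op (3, 7, 10) = (10, 6, 3)" "P_op (10, 6, 3) = (3, 7, 10)"
  "P_op (11, 3, 6) = (6, 2, 11)" "P_op (6, 2, 11) = (11, 3, 6)"
  "P_op (7, 11, 2) = (2, 10, 7)" "P_op (2, 10, 7) = (7, 11, 2)"
  by (simp_all add: P_op_apply Hex_Triads)

lemma L_op_Hex:
  "L_op (3, 7, 10) = (2, 10, 7)" "L_op (2, 10, 7) = (3, 7, 10)"
  "L_op (11, 3, 6) = (10, 6, 3)" "L_op (10, 6, 3) = (11, 3, 6)"
  "L_op (7, 11, 2) = (6, 2, 11)" "L_op (6, 2, 11) = (7, 11, 2)"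
  by (simp_all add: L_op_apply Hex_Triads)

lemma T_op_Hex:
  "T_op 4 (3, 7, 10) = (7, 11, 2)" "T_op 4 (7, 11, 2) = (11, 3, 6)"
  "T_op 4 (11, 3, 6) = (3, 7, 10)" "T_op 4 (10, 6, 3) = (2, 10, 7)"
  "T_op 4 (2, 10, 7) = (6, 2, 11)" "T_op 4 (6, 2, 11) = (10, 6, 3)"
  "T_op 8 (3, 7, 10) = (11, 3, 6)" "T_op 8 (7, 11, 2) = (3, 7, 10)"
  "T_op 8 (11, 3, 6) = (7, 11, 2)" "T_op 8 (10, 6, 3) = (6, 2, 11)"
  "T_op 8 (2, 10, 7) = (10, 6, 3)" "T_op 8 (6, 2, 11) = (2, 10, 7)"
  by (simp_all add: T_op_apply Hex_Triads)

lemma I_op_Hex: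
  "I_op 1 (3, 7, 10) = (10, 6, 3)" "I_op 1 (10, 6, 3) = (3, 7, 10)"
  "I_op 1 (11, 3, 6) = (2, 10, 7)" "I_op 1 (2, 10, 7) = (11, 3, 6)"
  "I_op 1 (7, 11, 2) = (6, 2, 11)" "I_op 1 (6, 2, 11) = (7, 11, 2)"
  "I_op 5 (3, 7, 10) = (2, 10, 7)" "I_op 5 (2, 10, 7) = (3, 7, 10)"
  "I_op 5 (11, 3, 6) = (6, 2, 11)" "I_op 5 (6, 2, 11) = (11, 3, 6)"
  "I_op 5 (7, 11, 2) = (10, 6, 3)" "I_op 5 (10, 6, 3) = (7, 11, 2)"
  "I_op 9 (3, 7, 10) = (6, 2, 11)" "I_op 9 (6, 2, 11) = (3, 7, 10)"
  "I_op 9 (11, 3, 6) = (10, 6, 3)" "I_op 9 (10, 6, 3) = (11, 3, 6)"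
  "I_op 9 (7, 11, 2) = (2, 10, 7)" "I_op 9 (2, 10, 7) = (7, 11, 2)"
  by (simp_all add: I_op_apply Hex_Triads)

lemma T_op_0: "t \<in> Triads \<Longrightarrow> T_op 0 t = t"
  by (cases t) (simp add: T_op_apply)

lemma card_Hex: "card Hex = 6"
  by (simp add: Hex_def)

text \<open>An injective self-map of a finite set is onto, so checking that the six triads stay in
  \<open>Hex\<close> is enough.\<close>

lemma bij_image_Hex_eq:
  assumes "f \<in> carrier (BijGroup Triads)" "f ` Hex \<subseteq> Hex"
  shows "f ` Hex = Hex"
proof (rule endo_inj_surj[OF _ assms(2)])
  have "inj_on f Triads"
    using assms(1) by (simp add: BijGroup_carrier Bij_def bij_betw_def)
  then show "inj_on f Hex"
    using Hex_subset_Triads by (rule inj_on_subset)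
qed (simp add: Hex_def)

lemma P_op_image_Hex: "P_op ` Hex = Hex"
  by (rule bij_image_Hex_eq[OF P_op_in_Sym])
    (simp add: Hex_def P_op_Hex del: eq_numeral_iff_iszero)

lemma L_op_image_Hex: "L_op ` Hex = Hex"
  by (rule bij_image_Hex_eq[OF L_op_in_Sym])
    (simp add: Hex_def L_op_Hex del: eq_numeral_iff_iszero)

definition TI_ops :: "(triple \<Rightarrow> triple) set" where
  "TI_ops = {T_op 0, T_op 4, T_op 8, I_op 1, I_op 5, I_op 9}"

lemma TI_ops_Bij: "j \<in> TI_ops \<Longrightarrow> j \<in> Bij Triads"
  using T_op_in_Sym I_op_in_Sym unfolding TI_ops_def BijGroup_carrier by blast

lemma TI_ops_image_Hex:
  assumes "j \<in> TI_ops"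
  shows "j ` Hex = Hex"
proof (rule bij_image_Hex_eq)
  show "j ` Hex \<subseteq> Hex"
    using assms unfolding TI_ops_def
    by (elim insertE emptyE)
      (simp_all add: Hex_def T_op_0 Hex_Triads T_op_Hex I_op_Hex del: eq_numeral_iff_iszero)
qed (use assms TI_ops_Bij in \<open>simp add: BijGroup_carrier\<close>)

lemma PL_group_Hex:
  assumes "f \<in> PL_group"
  shows "f \<in> Bij Triads" "f ` Hex = Hex" "\<And>j x. j \<in> TI_ops \<Longrightarrow> x \<in> Hex \<Longrightarrow> f (j x) = j (f x)"
proof -
  \<comment> \<open>A subgroup containing both generators, hence all of \<open>PL_group\<close>; its
    elements never have to be enumerated.\<close>
  let ?K = "{f \<in> Bij Triads. f ` Hex = Hex \<and> (\<forall>j\<in>TI_ops. \<forall>x\<in>Hex. f (j x) = j (f x))}"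
  have "subgroup ?K (BijGroup Triads)"
    using TI_ops_image_Hex by (intro subgroup_commuting_stabilizer Hex_subset_Triads) blast
  moreover have "{P_op, L_op} \<subseteq> ?K"
    using P_op_in_Sym L_op_in_Sym P_op_image_Hex L_op_image_Hex
    by (simp add: BijGroup_carrier TI_ops_def PL_TI_commute subsetD[OF Hex_subset_Triads])
  ultimately have "PL_group \<subseteq> ?K"
    unfolding PL_group_def by (intro group.generate_subgroup_incl[OF group_BijGroup])
  with assms show "f \<in> Bij Triads" "f ` Hex = Hex"
    "\<And>j x. j \<in> TI_ops \<Longrightarrow> x \<in> Hex \<Longrightarrow> f (j x) = j (f x)"
    by auto
qed

lemma PL_group_one: "(\<lambda>t\<in>Triads. t) \<in> PL_group"
  using generate.one[of "BijGroup Triads"] by (simp add: PL_group_def BijGroup_one)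

lemma P_op_in_PL_group: "P_op \<in> PL_group" and L_op_in_PL_group: "L_op \<in> PL_group"
  by (auto simp: PL_group_def intro: generate.incl)

lemma PL_group_compose: "f \<in> PL_group \<Longrightarrow> g \<in> PL_group \<Longrightarrow> compose Triads f g \<in> PL_group"
  using generate.eng[of f "BijGroup Triads" "{P_op, L_op}" g] PL_group_Hex(1)
  by (simp add: PL_group_def BijGroup_mult)

section \<open>Duality and dihedral structure of the restrictions\<close>

lemma TI_Hex_eq: "TI_Hex = (\<lambda>j. restrict j Hex) ` TI_ops"
  by (simp add: TI_Hex_def restrict_to_def TI_ops_def)

lemma PL_Hex_eq: "PL_Hex = (\<lambda>f. restrict f Hex) ` PL_group"
  by (simp add: PL_Hex_def restrict_to_def)

lemma Eb_in_Hex: "(3, 7, 10) \<in> Hex"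
  by (simp add: Hex_def)

lemma PL_Hex_transitive:
  assumes "y \<in> Hex"
  shows "\<exists>g\<in>PL_Hex. g (3, 7, 10) = y"
proof -
  have "\<exists>f\<in>PL_group. f (3, 7, 10) = y"
  proof -
    note mem = P_op_in_PL_group L_op_in_PL_group
    \<comment> \<open>Alternating words in P and L walk around the hexatonic cycle: from
      \<open>E\<flat>\<close>, P, LP and PLP reach e-flat, B and b, while L and PL reach g and
      G.\<close>
    note PL = PL_group_compose[OF mem] and LP = PL_group_compose[OF mem(2,1)]
    note ev = compose_eq Hex_Triads P_op_Hex L_op_Hex
    consider "y = (3, 7, 10)" | "y = (10, 6, 3)" | "y = (11, 3, 6)" | "y = (6, 2, 11)"
      | "y = (7, 11, 2)" | "y = (2, 10, 7)"
      using assms unfolding Hex_def by blast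
    then show ?thesis
    proof cases
      case 1
      show ?thesis by (rule bexI[OF _ PL_group_one]) (simp add: 1 ev)
    next
      case 2
      show ?thesis by (rule bexI[OF _ mem(1)]) (simp add: 2 ev)
    next
      case 3
      show ?thesis by (rule bexI[OF _ LP]) (simp add: 3 ev)
    next
      case 4
      show ?thesis by (rule bexI[OF _ PL_group_compose[OF mem(1) LP]]) (simp add: 4 ev)
    next
      case 5
      show ?thesis by (rule bexI[OF _ PL]) (simp add: 5 ev)
    next
      case 6
      show ?thesis by (rule bexI[OF _ mem(2)]) (simp add: 6 ev)
    qed
  qed
  then show ?thesis
    using Eb_in_Hex by (auto simp: PL_Hex_eq)
qed

lemma TI_Hex_transitive:
  assumes "y \<in> Hex"
  shows "\<exists>h\<in>TI_Hex. h (3, 7, 10) = y"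
proof -
  have "\<exists>j\<in>TI_ops. j (3, 7, 10) = y"
    using assms unfolding Hex_def TI_ops_def
    by (elim insertE emptyE)
      (simp_all add: T_op_0 Hex_Triads T_op_Hex I_op_Hex del: eq_numeral_iff_iszero)
  then show ?thesis
    using Eb_in_Hex by (auto simp: TI_Hex_eq)
qed

lemma Lewin_dual_Hex: "Lewin_dual Hex PL_Hex TI_Hex"
proof (rule Lewin_dualI[OF Eb_in_Hex])
  show "PL_Hex \<subseteq> Bij Hex"
    unfolding PL_Hex_eq
    by (intro image_subsetI restrict_in_Bij[OF _ Hex_subset_Triads] PL_group_Hex)
  show "TI_Hex \<subseteq> Bij Hex"
    unfolding TI_Hex_eq
    by (intro image_subsetI restrict_in_Bij[OF _ Hex_subset_Triads] TI_ops_Bij TI_ops_image_Hex)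
next
  fix g h x assume "g \<in> PL_Hex" "h \<in> TI_Hex" and x: "x \<in> Hex"
  then obtain f j where f: "f \<in> PL_group" "g = restrict f Hex" and j: "j \<in> TI_ops" "h = restrict j Hex"
    by (auto simp: PL_Hex_eq TI_Hex_eq)
  have "f x \<in> Hex" "j x \<in> Hex"
    using PL_group_Hex(2)[OF f(1)] TI_ops_image_Hex[OF j(1)] x by blast+
  then show "g (h x) = h (g x)"
    using PL_group_Hex(3)[OF f(1) j(1) x] f j x by simp
qed (fact PL_Hex_transitive TI_Hex_transitive)+

text \<open>LP runs through the major triads E-flat, B, G and returns, so it serves as the rotation;
  P is the reflection. The relations are evaluated at the E-flat triad only.\<close>

lemma dihedral_generators_PL_Hex:
  "dihedral_generators (perm_group Hex PL_Hex) 3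
     (restrict (compose Triads L_op P_op) Hex) (restrict P_op Hex)"
proof (rule simply_transitive_dihedral[OF _ _ card_Hex Eb_in_Hex])
  show "simply_transitive_action (perm_group Hex PL_Hex) Hex (\<lambda>g. g)"
    "subgroup PL_Hex (BijGroup Hex)"
    using Lewin_dual_Hex by (simp_all add: Lewin_dual_def)
  show "restrict (compose Triads L_op P_op) Hex \<in> PL_Hex" "restrict P_op Hex \<in> PL_Hex"
    by (simp_all add: PL_Hex_eq PL_group_compose P_op_in_PL_group L_op_in_PL_group)
qed (simp_all add: Hex_def compose_eq Hex_Triads P_op_Hex L_op_Hex)

text \<open>Transposition by 4 runs through E-flat, G, B and returns; \<open>I_op 1\<close>
  exchanges E-flat major and minor.\<close>

lemma dihedral_generators_TI_Hex:
  "dihedral_generators (perm_group Hex TI_Hex) 3 (restrict (T_op 4) Hex) (restrict (I_op 1) Hex)"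
proof (rule simply_transitive_dihedral[OF _ _ card_Hex Eb_in_Hex])
  show "simply_transitive_action (perm_group Hex TI_Hex) Hex (\<lambda>g. g)"
    "subgroup TI_Hex (BijGroup Hex)"
    using Lewin_dual_Hex by (simp_all add: Lewin_dual_def)
  show "restrict (T_op 4) Hex \<in> TI_Hex" "restrict (I_op 1) Hex \<in> TI_Hex"
    by (auto simp: TI_Hex_eq TI_ops_def)
qed (simp_all add: Hex_def T_op_Hex I_op_Hex)

theorem theorem3p9:
  shows "Lewin_dual Hex PL_Hex TI_Hex \<and>
    (perm_group Hex PL_Hex \<cong> dihedral_group_6 \<and> order (perm_group Hex PL_Hex) = 6) \<and>
    (perm_group Hex TI_Hex \<cong> dihedral_group_6 \<and> order (perm_group Hex TI_Hex) = 6)"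
proof (intro conjI)
  show dual: "Lewin_dual Hex PL_Hex TI_Hex"
    by (rule Lewin_dual_Hex)
  show "perm_group Hex PL_Hex \<cong> dihedral_group_6"
    using dihedral_generators_PL_Hex dihedral_generators_triangle by (rule dihedral_generators_iso)
  show "perm_group Hex TI_Hex \<cong> dihedral_group_6"
    using dihedral_generators_TI_Hex dihedral_generators_triangle by (rule dihedral_generators_iso)
  show "order (perm_group Hex PL_Hex) = 6" "order (perm_group Hex TI_Hex) = 6"
    using dual simply_transitive_order[OF _ _ Eb_in_Hex] by (simp_all add: Lewin_dual_def card_Hex)
qed

end
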